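(* Let $p$ be an odd prime and $z\in\mathbb{F}_p$ with $z\neq0,-4$ such that $z^2+4z$ is a square in $\mathbb{F}_p$. Then the two elements $\frac{-(z+2)\pm\sqrt{z^2+4z}}{2}$ of $\mathbb{F}_p^*$ both have multiplicative order $\alpha(z,p)$.
   Context: $\mathbb{F}$ is an algebraic closure of $\mathbb{F}_p$. For $x,y\in\mathbb{F}$, $[i,j]:=x^{p^i}y^{p^j}-x^{p^j}y^{p^i}$ and, for $x,y$ linearly independent over $\mathbb{F}_p$, $\nu(x,y):=-\frac{[0,2][1,3]}{[0,1][2,3]}$. For $m\ge1$, $\mathcal{Z}(m)=\{\nu(x,y):x,y\in\mathbb{F}_{p^m}\text{ lin. indep. over }\mathbb{F}_p\}$, $f_{m,p}(X)=\prod_{w\in\mathcal{Z}(m)\setminus\{0\}}(X-w)$. The order of appearance $\alpha(z,p)$ is the least $m\ge1$ with $f_{m,p}(z)=0$. *)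

theory Defs
  imports "HOL-Computational_Algebra.Computational_Algebra"
begin

text \<open>
  Throughout, the ambient type \<open>'a\<close> plays the role of the algebraic closure of the field with
  \<open>p\<close> elements; in the theorem it is an algebraically closed field of characteristic \<open>p\<close> that is
  algebraic over its prime field.  The field with \<open>p\<close> elements is the image of the integers.
\<close>

definition prime_field :: "'a::field set" where
  "prime_field = range of_int"

text \<open>
  The field with \<open>p ^ m\<close> elements inside the algebraic closure, as the set of fixed points of the
  \<open>m\<close>-th power of Frobenius; \<open>GF_unique_subfield\<close> below shows that this is the unique subfield
  with \<open>p ^ m\<close> elements.
\<close>

definition GF :: "nat \<Rightarrow> nat \<Rightarrow> 'a::field set" where
  "GF p m = {x. x ^ (p ^ m) = x}"

definition is_subfield :: "'a::field set \<Rightarrow> bool" where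
  "is_subfield K \<longleftrightarrow> 0 \<in> K \<and> 1 \<in> K \<and>
     (\<forall>x\<in>K. \<forall>y\<in>K. x + y \<in> K \<and> x * y \<in> K) \<and> (\<forall>x\<in>K. - x \<in> K \<and> inverse x \<in> K)"

definition lin_indep2 :: "'a::field \<Rightarrow> 'a \<Rightarrow> bool" where
  "lin_indep2 x y \<longleftrightarrow>
     (\<forall>a\<in>prime_field. \<forall>b\<in>prime_field. a * x + b * y = 0 \<longrightarrow> a = 0 \<and> b = 0)"

definition bracket :: "nat \<Rightarrow> 'a::field \<Rightarrow> 'a \<Rightarrow> nat \<Rightarrow> nat \<Rightarrow> 'a" where
  "bracket p x y i j = x ^ (p ^ i) * y ^ (p ^ j) - x ^ (p ^ j) * y ^ (p ^ i)"

text \<open>Only meant for \<open>x\<close>, \<open>y\<close> with \<open>lin_indep2 x y\<close>, when the denominator does not vanish.\<close>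

definition nu :: "nat \<Rightarrow> 'a::field \<Rightarrow> 'a \<Rightarrow> 'a" where
  "nu p x y = - ((bracket p x y 0 2 * bracket p x y 1 3) / (bracket p x y 0 1 * bracket p x y 2 3))"

definition Z_set :: "nat \<Rightarrow> nat \<Rightarrow> 'a::field set" where
  "Z_set p m = {nu p x y | x y. x \<in> GF p m \<and> y \<in> GF p m \<and> lin_indep2 x y}"

text \<open>For prime \<open>p\<close> the index set is finite (\<open>finite_Z_set\<close> below), so the product is genuine.\<close>

definition f_poly :: "nat \<Rightarrow> nat \<Rightarrow> 'a::field poly" where
  "f_poly p m = (\<Prod>w\<in>Z_set p m - {0}. [:- w, 1:])"

definition order_of_appearance :: "'a::field \<Rightarrow> nat \<Rightarrow> nat" where
  "order_of_appearance z p = (LEAST m. 1 \<le> m \<and> poly (f_poly p m) z = 0)"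

definition mult_order :: "'a::field \<Rightarrow> nat" where
  "mult_order x = (LEAST n. 1 \<le> n \<and> x ^ n = 1)"

lemma GF_card:
  fixes p m :: nat
  assumes p: "prime p" "CHAR('a::alg_closed_field) = p" and m: "1 \<le> m"
  shows "finite (GF p m :: 'a set)" and "card (GF p m :: 'a set) = p ^ m"
proof -
  define q where "q = p ^ m"
  have q1: "1 < q"
    using p(1) m unfolding q_def by (intro one_less_power) (auto simp: prime_gt_Suc_0_nat)
  define P :: "'a poly" where "P = monom 1 q - monom 1 1"
  have deg: "degree P = q"
  proof -
    have "degree (monom 1 q + - monom 1 1 :: 'a poly) = degree (monom 1 q :: 'a poly)"
      by (rule degree_add_eq_left) (use q1 in \<open>simp add: degree_monom_eq\<close>)
    thus ?thesis by (simp add: P_def degree_monom_eq)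
  qed
  have P0: "P \<noteq> 0" using deg q1 by auto
  have lc: "lead_coeff P = 1"
    using q1 unfolding deg by (simp add: P_def)
  have q0: "(of_nat q :: 'a) = 0"
    unfolding of_nat_eq_0_iff_char_dvd using p(2) m by (simp add: q_def)
  have pd: "pderiv P = [:-1:]"
    using q0 by (simp add: P_def pderiv_diff pderiv_monom monom_0)
  obtain A where A: "size A = degree P" "P = smult (lead_coeff P) (\<Prod>x\<in>#A. [:-x, 1:])"
    using alg_closed_imp_factorization[OF P0] by blast
  hence PA: "P = (\<Prod>x\<in>#A. [:-x, 1:])" using lc by simp
  have roots: "GF p m = set_mset A"
  proof -
    have "GF p m = {x. poly P x = 0}"
      by (auto simp: GF_def P_def poly_monom q_def)
    also have "\<dots> = set_mset A"
      unfolding PA by (auto simp: poly_prod_mset prod_mset_zero_iff)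
    finally show ?thesis .
  qed
  have "count A x \<le> 1" for x
  proof (rule ccontr)
    assume "\<not> count A x \<le> 1"
    hence "{#x, x#} \<subseteq># A" by (auto simp: subseteq_mset_def)
    then obtain B where "A = {#x, x#} + B" by (auto simp: subset_mset.le_iff_add)
    hence "P = [:-x, 1:] * ([:-x, 1:] * (\<Prod>y\<in>#B. [:-y, 1:]))"
      using PA by simp
    then obtain R where "P = [:-x, 1:] * ([:-x, 1:] * R)" by blast
    hence "poly (pderiv P) x = 0"
      by (simp only: pderiv_mult poly_add poly_mult) simp
    thus False by (simp add: pd)
  qed
  hence "A = mset_set (set_mset A)"
    by (intro multiset_eqI)
       (metis count_eq_zero_iff count_mset_set(1) count_mset_set(3) finite_set_mset le_antisym
          less_one linorder_not_le)
  hence "card (set_mset A) = size A" by (metis size_mset_set)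
  thus "finite (GF p m :: 'a set)" "card (GF p m :: 'a set) = p ^ m"
    unfolding roots using A(1) deg by (auto simp: q_def)
qed

lemma GF_is_subfield:
  fixes p m :: nat
  assumes p: "prime p" "CHAR('a::field) = p"
  shows "is_subfield (GF p m :: 'a set)"
proof -
  have pp: "p ^ m > 0" using p prime_gt_0_nat by auto
  have add: "(x + y) ^ (p ^ m) = x ^ (p ^ m) + y ^ (p ^ m)" for x y :: 'a
    using p by (intro freshmans_dream') auto
  have neg: "(- x) ^ (p ^ m) = - x" if "x ^ (p ^ m) = x" for x :: 'a
  proof -
    have "(0 :: 'a) ^ (p ^ m) = 0" using pp by (rule zero_power)
    hence "x + (- x) ^ (p ^ m) = 0"
      using add[of x "-x"] that by (metis add.right_inverse)
    thus ?thesis by (simp add: eq_neg_iff_add_eq_0 add.commute)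
  qed
  show ?thesis
    using pp by (auto simp: is_subfield_def GF_def add neg power_mult_distrib power_inverse)
qed

lemma subfield_le_GF:
  fixes K :: "'a::field set"
  assumes K: "is_subfield K" and fin: "finite K" and card: "card K = p ^ m"
  shows "K \<subseteq> GF p m"
proof
  fix x assume x: "x \<in> K"
  have pos: "card K > 0" using fin x card_gt_0_iff by blast
  show "x \<in> GF p m"
  proof (cases "x = 0")
    case True
    thus ?thesis using pos card by (simp add: GF_def)
  next
    case False
    have mem: "x * y \<in> K" "y / x \<in> K" if "y \<in> K" for y
      using K x that unfolding is_subfield_def divide_inverse by auto
    have "(\<Prod>y\<in>K - {0}. x * y) = (\<Prod>y\<in>K - {0}. y)"
      by (rule prod.reindex_bij_witness[of _ "\<lambda>y. y / x" "\<lambda>y. x * y"]) (use False mem in auto)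
    hence "x ^ card (K - {0}) * \<Prod>(K - {0}) = \<Prod>(K - {0})"
      by (simp add: prod.distrib)
    moreover have "\<Prod>(K - {0}) \<noteq> 0" using fin by simp
    ultimately have "x ^ card (K - {0}) = 1" by simp
    moreover have "card K = Suc (card (K - {0}))"
      using fin K by (intro card.remove) (auto simp: is_subfield_def)
    ultimately have "x ^ card K = x" by simp
    thus ?thesis by (simp add: GF_def card)
  qed
qed

lemma GF_unique_subfield:
  fixes p m :: nat and K :: "'a::alg_closed_field set"
  assumes p: "prime p" "CHAR('a) = p" and m: "1 \<le> m"
  shows "is_subfield K \<and> card K = p ^ m \<longleftrightarrow> K = GF p m"
proof
  assume K: "is_subfield K \<and> card K = p ^ m"
  have "p ^ m > 0" using p prime_gt_0_nat by auto
  hence "finite K" using K card_gt_0_iff[of K] by auto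
  with K have "K \<subseteq> GF p m" by (intro subfield_le_GF) auto
  thus "K = GF p m"
    using GF_card[OF p m] K by (intro card_subset_eq) auto
qed (use GF_is_subfield[OF p] GF_card[OF p m] in auto)

lemma finite_Z_set:
  fixes p m :: nat
  assumes "prime p" "CHAR('a::alg_closed_field) = p" "1 \<le> m"
  shows "finite (Z_set p m :: 'a set)"
proof (rule finite_subset)
  show "(Z_set p m :: 'a set) \<subseteq> (\<lambda>(x, y). nu p x y) ` (GF p m \<times> GF p m)"
    by (auto simp: Z_set_def)
  show "finite ((\<lambda>(x, y). nu p x y) ` (GF p m \<times> GF p m :: ('a \<times> 'a) set))"
    using GF_card(1)[OF assms] by simp
qed

end

theory Submission
  imports Defs
begin

text \<open>
  If \<open>w\<close> is one of the two elements, then \<open>w + 1 / w = - (z + 2)\<close>.  With \<open>t = y / x\<close>,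
  \<open>a = t ^ p - t\<close> and \<open>b = a ^ (p - 1)\<close> one has \<open>\<nu>(x, y) = - (1 + b) (1 + b ^ p) / b ^ p\<close>, so that
  \<open>\<nu>(x, y) = z\<close> says that \<open>b ^ p\<close> is the image of \<open>b\<close> under a Moebius transformation.  Its fixed
  points are \<open>w\<close> and \<open>1 / w\<close>, with multiplier \<open>w\<close> at \<open>w\<close>.  So either \<open>b\<close> is a fixed point,
  i.e. \<open>a ^ p = w a\<close> or \<open>a ^ p = a / w\<close>, or the coordinate \<open>c = (b - w) / (w b - 1)\<close> satisfies
  \<open>c ^ p = w c\<close>.  Iterating \<open>u ^ p = w u\<close> gives \<open>u ^ (p ^ m) = w ^ m u\<close>, hence \<open>w ^ m = 1\<close> as soon
  as \<open>u\<close> is a nonzero element of the field with \<open>p ^ m\<close> elements.  Conversely, if \<open>w ^ m = 1\<close>, the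
  choice \<open>b = w\<close> is realised by some \<open>t\<close> in that field, because the trace of \<open>a\<close> is
  \<open>a (1 + w + \<dots> + w ^ (m - 1)) = 0\<close>.
\<close>

section \<open>Finite subfields and the Frobenius map\<close>

lemma GF_closed:
  fixes x y :: "'a::field"
  assumes "prime p" "CHAR('a) = p" "x \<in> GF p m" "y \<in> GF p m"
  shows "x + y \<in> GF p m" "x - y \<in> GF p m" "x * y \<in> GF p m" "x / y \<in> GF p m"
proof -
  have K: "is_subfield (GF p m :: 'a set)" by (rule GF_is_subfield[OF assms(1,2)])
  show "x + y \<in> GF p m" "x * y \<in> GF p m" using K assms(3,4) by (auto simp: is_subfield_def)
  have "x + - y \<in> GF p m" using K assms(3,4) unfolding is_subfield_def by blast
  thus "x - y \<in> GF p m" by simp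
  have "x * inverse y \<in> GF p m" using K assms(3,4) unfolding is_subfield_def by blast
  thus "x / y \<in> GF p m" by (simp add: divide_inverse)
qed

lemma GF_one: "(1 :: 'a::field) \<in> GF p m"
  by (simp add: GF_def)

lemma GF_power: "x \<in> GF p m \<Longrightarrow> (x :: 'a::field) ^ k \<in> GF p m"
  unfolding GF_def by (simp, metis power_mult mult.commute)

text \<open>Stepping up and down from 1 reaches every integer, and \<open>GF p 1\<close> contains 1
  and is closed under both steps.\<close>

lemma prime_field_frobenius:
  fixes x :: "'a::field"
  assumes "prime p" "CHAR('a) = p" "x \<in> prime_field"
  shows "x ^ p = x"
proof -
  have "(of_int k :: 'a) \<in> GF p 1" for k
  proof (induction k rule: int_induct[where k = 1])
    case base
    show ?case by (simp add: GF_one)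
  next
    case (step1 i)
    thus ?case using GF_closed(1)[OF assms(1,2) _ GF_one] by simp
  next
    case (step2 i)
    thus ?case using GF_closed(2)[OF assms(1,2) _ GF_one] by simp
  qed
  thus ?thesis using assms(3) by (auto simp: prime_field_def GF_def)
qed

lemma frobenius_diff:
  fixes x y :: "'a::field"
  assumes "prime p" "CHAR('a) = p"
  shows "(x - y) ^ (p ^ k) = x ^ (p ^ k) - y ^ (p ^ k)"
  using freshmans_dream'[of "p ^ k" k "x - y" y] assms by (simp add: eq_diff_eq)

lemma frobenius_eigen_iterate:
  fixes u w :: "'a::field"
  assumes "u ^ p = w * u" "w ^ p = w"
  shows "u ^ (p ^ k) = w ^ k * u"
proof (induction k)
  case (Suc k)
  have "u ^ (p ^ Suc k) = (u ^ (p ^ k)) ^ p" by (simp add: mult.commute flip: power_mult)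
  also have "\<dots> = (w ^ p) ^ k * u ^ p"
    by (simp add: Suc power_mult_distrib mult.commute flip: power_mult)
  finally show ?case by (simp add: assms)
qed simp

lemma frobenius_eigen_order:
  fixes u w :: "'a::field"
  assumes "u ^ p = w * u" "w ^ p = w" "u \<in> GF p m" "u \<noteq> 0"
  shows "w ^ m = 1"
  using frobenius_eigen_iterate[OF assms(1,2), of m] assms(3,4) by (simp add: GF_def)

section \<open>The invariant \<nu> in terms of b\<close>

lemma nu_quotient:
  fixes x y :: "'a::field"
  assumes "x \<noteq> 0"
  shows "nu p x y = nu p 1 (y / x)"
proof -
  have br: "bracket p x y i j = x ^ (p ^ i) * x ^ (p ^ j) * bracket p 1 (y / x) i j" for i j
    using assms by (simp add: bracket_def power_divide field_simps)
  \<comment> \<open>Numerator and denominator both pick up x to the power 1 + p + p^2 + p^3, which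
    cancels.\<close>
  show ?thesis using assms by (simp add: nu_def br)
qed

text \<open>The iterates of t under Frobenius are partial sums of t, a, b a, b^p b a, and each
  bracket of 1 and t is a difference of two of them.\<close>

lemma nu_one:
  fixes t :: "'a::field"
  assumes "prime p" "CHAR('a) = p"
    and a: "a = t ^ p - t" and ab: "a ^ p = b * a" and "a \<noteq> 0"
  shows "nu p 1 t = - ((1 + b) * (1 + b ^ p) / b ^ p)"
proof -
  have pp: "p > 0" using assms(1) prime_gt_0_nat by blast
  have b0: "b \<noteq> 0" using ab \<open>a \<noteq> 0\<close> pp by auto
  have fa: "(u + v) ^ p = u ^ p + v ^ p" for u v :: 'a
    by (rule freshmans_dream) (use assms(1,2) in auto)
  have s: "t ^ (p ^ Suc k) = (t ^ (p ^ k)) ^ p" for k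
    by (metis power_Suc2 power_mult)
  have s1: "t ^ (p ^ 1) = t + a" by (simp add: a)
  have "t ^ (p ^ Suc 1) = (t + a) ^ p" by (simp only: s s1)
  also have "\<dots> = t + a + b * a" using s1 by (simp add: fa ab)
  finally have s2: "t ^ (p ^ 2) = t + a + b * a" by (simp only: Suc_1)
  have "t ^ (p ^ Suc 2) = (t + a + b * a) ^ p" by (simp only: s s2)
  also have "\<dots> = t + a + b * a + b ^ p * (b * a)"
    using s1 by (simp add: fa ab power_mult_distrib)
  finally have s3: "t ^ (p ^ 3) = t + a + b * a + b ^ p * (b * a)" by simp
  have b02: "bracket p 1 t 0 2 = a * (1 + b)"
    and b13: "bracket p 1 t 1 3 = a * b * (1 + b ^ p)"
    and b01: "bracket p 1 t 0 1 = a" and b23: "bracket p 1 t 2 3 = a * b * b ^ p"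
    by (simp_all only: bracket_def s1 s2 s3) (simp_all add: algebra_simps)
  show ?thesis unfolding nu_def b02 b13 b01 b23
    using \<open>a \<noteq> 0\<close> b0 by (simp add: field_simps)
qed

section \<open>From a value of \<nu> to the order of w\<close>

lemma nu_eq_imp_order:
  fixes x y w :: "'a::field"
  assumes "prime p" "CHAR('a) = p"
    and x: "x \<in> GF p m" and y: "y \<in> GF p m"
    and nu: "nu p x y = z" and z0: "z \<noteq> 0"
    and w: "w ^ p = w" "w \<noteq> 0" "w ^ 2 + (z + 2) * w + 1 = 0"
  shows "w ^ m = 1"
proof -
  have pp: "p > 0" using assms(1) prime_gt_0_nat by blast
  \<comment> \<open>Division by zero gives 0, so a vanishing \<open>bracket p x y 0 1\<close> would
    make \<nu> zero, against \<open>z0\<close>.\<close>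
  have x0: "x \<noteq> 0"
  proof
    assume "x = 0"
    hence "bracket p x y 0 1 = 0" using pp by (simp add: bracket_def)
    thus False using nu z0 by (simp add: nu_def)
  qed
  define t where "t = y / x"
  define a where "a = t ^ p - t"
  define b where "b = a ^ (p - 1)"
  have nt: "nu p 1 t = z" using nu nu_quotient[OF x0, of p y] by (simp add: t_def)
  have a0: "a \<noteq> 0"
  proof
    assume "a = 0"
    hence "bracket p 1 t 0 1 = 0" by (simp add: bracket_def a_def)
    thus False using nt z0 by (simp add: nu_def)
  qed
  have tm: "t \<in> GF p m" unfolding t_def using GF_closed[OF assms(1,2) y x] by blast
  have am: "a \<in> GF p m" unfolding a_def using GF_closed[OF assms(1,2) GF_power[OF tm] tm] by blast
  have bm: "b \<in> GF p m" unfolding b_def using am by (rule GF_power)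
  \<comment> \<open>Here w is an eigenvector of Frobenius with eigenvalue 1.\<close>
  have wm: "w \<in> GF p m" using frobenius_eigen_iterate[of w p 1 m] w(1) by (simp add: GF_def)
  have ab: "a ^ p = b * a"
    unfolding b_def using pp by (metis power_minus_mult)
  have b0: "b \<noteq> 0" using ab a0 pp by auto
  have "z = - ((1 + b) * (1 + b ^ p) / b ^ p)"
    using nu_one[OF assms(1,2) a_def ab a0] nt by simp
  hence E: "z * b ^ p = - ((1 + b) * (1 + b ^ p))" using b0 by simp
  consider "b = w" | "w * b = 1" | "b \<noteq> w" "w * b \<noteq> 1" by blast
  thus ?thesis
  proof cases
    case 1
    show ?thesis using frobenius_eigen_order[OF _ w(1) am a0] ab 1 by simp
  next
    case 2
    hence "b = inverse w" using w(2) by (simp add: field_simps)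
    hence "inverse w ^ m = 1"
      using frobenius_eigen_order[of a p "inverse w" m] ab w(1) am a0 by (simp add: power_inverse)
    thus ?thesis by (simp add: power_inverse)
  next
    case 3
    \<comment> \<open>This sends the fixed points w and 1 / w to 0 and infinity; both are excluded
      here, so c is finite and nonzero.\<close>
    define c where "c = (b - w) / (w * b - 1)"
    have c0: "c \<noteq> 0" using 3 by (simp add: c_def)
    have fr: "(u - v) ^ p = u ^ p - v ^ p" for u v :: 'a
      using frobenius_diff[OF assms(1,2), of u v 1] by simp
    have cp: "c ^ p = (b ^ p - w) / (w * b ^ p - 1)"
      by (simp add: c_def power_divide fr power_mult_distrib w(1))
    have "(w * b - 1) ^ p \<noteq> 0" using 3 by simp
    hence d: "w * b ^ p - 1 \<noteq> 0" by (simp add: fr power_mult_distrib w(1))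
    have "(b ^ p - w) * (w * b - 1) = w * (b - w) * (w * b ^ p - 1)"
    proof -
      \<comment> \<open>Modulo the quadratic for w, the two sides differ by (1 - w) w (z B + (1 + b)
        (1 + B)).\<close>
      have "(B - w) * (w * b - 1) = w * (b - w) * (w * B - 1)"
        if "z * B = - ((1 + b) * (1 + B))" for B
        using that w(3) by algebra
      thus ?thesis using E by blast
    qed
    moreover have "w * b - 1 \<noteq> 0" using 3 by simp
    ultimately have "c ^ p = w * (b - w) / (w * b - 1)"
      unfolding cp using d by (simp only: frac_eq_eq not_False_eq_True)
    hence "c ^ p = w * c" by (simp add: c_def)
    moreover have "c \<in> GF p m"
      unfolding c_def by (intro GF_closed[OF assms(1,2)] bm wm GF_one)
    ultimately show ?thesis by (rule frobenius_eigen_order[OF _ w(1) _ c0])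
  qed
qed

section \<open>From the order of w to a value of \<nu>\<close>

lemma ex_artin_schreier_root:
  fixes a :: "'a::alg_closed_field"
  assumes "p > 1"
  shows "\<exists>t. t ^ p - t = a"
proof -
  define P :: "'a poly" where "P = monom 1 p + (- monom 1 1 - [:a:])"
  have "degree (- monom 1 1 - [:a:] :: 'a poly) \<le> 1"
    by (intro degree_diff_le) (auto simp: degree_monom_eq)
  hence "degree P = p"
    unfolding P_def using assms by (subst degree_add_eq_left) (auto simp: degree_monom_eq)
  hence "degree P > 0" using assms by simp
  then obtain t where "poly P t = 0"
    using alg_closed_imp_poly_has_root by blast
  thus ?thesis by (intro exI[of _ t]) (simp add: P_def poly_monom algebra_simps)
qed

lemma order_imp_nu_eq:
  fixes w z :: "'a::alg_closed_field"
  assumes "prime p" "CHAR('a) = p"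
    and w: "w ^ p = w" "w \<noteq> 0" "w \<noteq> 1" "w ^ 2 + (z + 2) * w + 1 = 0"
    and wm: "w ^ m = 1"
  shows "z \<in> Z_set p m"
proof -
  have p1: "p > 1" using assms(1) prime_gt_1_nat by blast
  \<comment> \<open>This choice makes b equal to the fixed point w.\<close>
  obtain a where aw: "a ^ (p - 1) = w"
    using nth_root_exists[of "p - 1" w] p1 by auto
  have a0: "a \<noteq> 0" using aw w(2) p1 by (auto simp: power_0_left)
  have ap: "a ^ p = w * a" using aw p1 power_minus_mult[of p a] by simp
  obtain t where t: "t ^ p - t = a" using ex_artin_schreier_root[OF p1] by blast
  have it: "t ^ (p ^ k) = t + a * (\<Sum>i<k. w ^ i)" for k
  proof (induction k)
    case (Suc k)
    have "t ^ (p ^ Suc k) = (t ^ p) ^ (p ^ k)" by (simp flip: power_mult)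
    also have "t ^ p = t + a" using t by (simp add: algebra_simps)
    also have "(t + a) ^ (p ^ k) = t ^ (p ^ k) + a ^ (p ^ k)"
      using assms(1,2) by (intro freshmans_dream') auto
    finally show ?case
      by (simp add: Suc frobenius_eigen_iterate[OF ap w(1)] algebra_simps)
  qed simp
  \<comment> \<open>Since w is not 1, the geometric sum itself vanishes.\<close>
  have "(w - 1) * (\<Sum>i<m. w ^ i) = 0" using wm by (simp add: power_diff_1_eq[symmetric])
  hence "t ^ (p ^ m) = t" using w(3) by (simp add: it)
  hence tm: "t \<in> GF p m" by (simp add: GF_def)
  \<comment> \<open>A dependence would put t in the prime field, where Frobenius is the identity, so
    a would be 0.\<close>
  have "lin_indep2 1 t"
    unfolding lin_indep2_def
  proof (intro ballI impI)
    fix \<alpha> \<beta> :: 'a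
    assume m: "\<alpha> \<in> prime_field" "\<beta> \<in> prime_field" and e: "\<alpha> * 1 + \<beta> * t = 0"
    note fr = m[THEN prime_field_frobenius[OF assms(1,2)]]
    have "\<beta> = 0"
    proof (rule ccontr)
      assume "\<beta> \<noteq> 0"
      hence "t = (0 - \<alpha>) / \<beta>" using e by (simp add: field_simps eq_neg_iff_add_eq_0)
      moreover have "(0 - \<alpha>) ^ p = 0 - \<alpha>"
        using frobenius_diff[OF assms(1,2), of 0 \<alpha> 1] fr(1) p1 by simp
      ultimately have "t ^ p = t" using fr(2) by (simp only: power_divide)
      thus False using t a0 by simp
    qed
    thus "\<alpha> = 0 \<and> \<beta> = 0" using e by simp
  qed
  moreover have "nu p 1 t = z"
  proof -
    have "nu p 1 t = - ((1 + w) * (1 + w) / w)"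
      using nu_one[OF assms(1,2) t[symmetric] ap a0] w(1) by simp
    moreover have "- ((1 + w) * (1 + w)) = z * w" using w(4) by algebra
    ultimately show ?thesis using w(2) by (simp add: field_simps)
  qed
  ultimately show ?thesis using tm GF_one[of p m] unfolding Z_set_def by blast
qed

section \<open>The roots in the prime field and the conclusion\<close>

lemma prime_field_half:
  fixes x :: "'a::field"
  assumes "odd p" "CHAR('a) = p" "x \<in> prime_field"
  shows "x / 2 \<in> prime_field" and "(2 :: 'a) \<noteq> 0"
proof -
  obtain k where k: "p = 2 * k + 1" using assms(1) by (elim oddE)
  have "(of_nat p :: 'a) = 0" using assms(2) by (simp add: of_nat_eq_0_iff_char_dvd)
  hence e: "2 * of_nat k + (1 :: 'a) = 0" by (simp add: k add.commute)
  thus 2: "(2 :: 'a) \<noteq> 0" by auto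
  obtain i where i: "x = of_int i" using assms(3) by (auto simp: prime_field_def)
  \<comment> \<open>For p = 2 k + 1 the inverse of 2 is -k, which keeps the half in the image of the
    integers.\<close>
  have "x = 2 * (- of_nat k * x)" using e by algebra
  hence "x / 2 = - of_nat k * x" using 2 by (simp add: field_simps)
  also have "\<dots> = of_int (- int k * i)" by (simp add: i)
  finally show "x / 2 \<in> prime_field" unfolding prime_field_def by blast
qed

lemma prime_field_closed:
  fixes x y :: "'a::field"
  assumes "x \<in> prime_field" "y \<in> prime_field"
  shows "x + y \<in> prime_field" "x - y \<in> prime_field" "- x \<in> prime_field"
  using assms unfolding prime_field_def
  by (auto simp flip: of_int_add of_int_diff of_int_minus)

theorem theorem9p5:
  fixes p :: nat and z s :: "'a::alg_closed_field"
  assumes "prime p" and "odd p"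
    and "CHAR('a) = p"
    and "\<And>x :: 'a. \<exists>g. g \<noteq> 0 \<and> (\<forall>i. coeff g i \<in> prime_field) \<and> poly g x = 0"
    and "z \<in> prime_field" and "z \<noteq> 0" and "z \<noteq> -4"
    and "s \<in> prime_field" and "s ^ 2 = z ^ 2 + 4 * z"
  shows "\<forall>w \<in> {(- (z + 2) + s) / 2, (- (z + 2) - s) / 2}.
           w \<in> prime_field - {0} \<and> mult_order w = order_of_appearance z p"
proof
  fix w :: 'a
  assume w: "w \<in> {(- (z + 2) + s) / 2, (- (z + 2) - s) / 2}"
  note half = prime_field_half[OF assms(2,3)]
  have two: "(2 :: 'a) \<noteq> 0" by (rule half(2)[OF assms(5)])
  have "(2 :: 'a) = of_int 2" by simp
  hence "(2 :: 'a) \<in> prime_field" unfolding prime_field_def by blast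
  hence wpf: "w \<in> prime_field"
    using w assms(5,8) by (elim insertE) (simp_all only: half(1) prime_field_closed empty_iff)
  have "2 * w = - (z + 2) + s \<or> 2 * w = - (z + 2) - s"
    using w two by (auto simp: mult.commute)
  hence "(2 * w + (z + 2)) ^ 2 = s ^ 2"
  proof
    assume "2 * w = - (z + 2) + s"
    thus ?thesis by algebra
  next
    assume "2 * w = - (z + 2) - s"
    thus ?thesis by algebra
  qed
  hence "(2 * w + (z + 2)) ^ 2 = z ^ 2 + 4 * z" by (simp only: assms(9))
  \<comment> \<open>The factor 4 is split so that \<open>two\<close> cancels each half.\<close>
  hence "2 * (2 * (w ^ 2 + (z + 2) * w + 1)) = 0" by algebra
  hence q: "w ^ 2 + (z + 2) * w + 1 = 0" using two by (simp only: mult_eq_0_iff simp_thms)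
  have w0: "w \<noteq> 0" using q by auto
  have w1: "w \<noteq> 1"
  proof
    assume "w = 1"
    hence "z = -4" using q by algebra
    thus False using assms(7) by simp
  qed
  have wp: "w ^ p = w" by (rule prime_field_frobenius[OF assms(1,3) wpf])
  \<comment> \<open>The predicates under the two \<open>LEAST\<close> operators agree for every m,
    so no minimum has to be computed.\<close>
  have "poly (f_poly p m) z = 0 \<longleftrightarrow> w ^ m = 1" if m: "1 \<le> m" for m
  proof -
    have "poly (f_poly p m) z = 0 \<longleftrightarrow> z \<in> Z_set p m"
      using finite_Z_set[OF assms(1,3) m] assms(6)
      by (auto simp: f_poly_def poly_prod)
    also have "\<dots> \<longleftrightarrow> w ^ m = 1"
      using order_imp_nu_eq[OF assms(1,3) wp w0 w1 q]
        nu_eq_imp_order[OF assms(1,3) _ _ _ assms(6) wp w0 q]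
      by (auto simp: Z_set_def)
    finally show ?thesis .
  qed
  hence "(\<lambda>m. 1 \<le> m \<and> w ^ m = 1) = (\<lambda>m. 1 \<le> m \<and> poly (f_poly p m) z = 0)" by blast
  hence "mult_order w = order_of_appearance z p"
    unfolding mult_order_def order_of_appearance_def by (rule arg_cong)
  thus "w \<in> prime_field - {0} \<and> mult_order w = order_of_appearance z p"
    using wpf w0 by simp
qed

end
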